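(* Let $\mu$ be a quasi-definite complex Borel measure supported on $\mathbb T$ and let $\vec n=(n_+,n_-)\in\mathbb Z_+^2$. The Christoffel--Darboux kernel for the extended ordering, $K_{\vec n}^{[l]}(z,z')=\sum_{k=0}^{l-1}\varphi_{\vec n,1}^{(k)}(z')\,\bar\varphi_{\vec n,2}^{(k)}(\bar z)$, is given, for $z,z'\neq0$ and $z'\bar z\neq1$, by $$K_{\vec n}^{[l]}(z,z')=\frac{\bar z\,\bar\varphi_{\vec n,2,+2}^{(l)}(\bar z)\,\varphi_{\vec n,1,-2}^{(l-1)}(z')-\varphi_{\vec n,1,+1}^{(l)}(z')\,\bar z\,\bar\varphi_{\vec n,2,-1}^{(l-1)}(\bar z)}{1-z'\bar z}.$$
   Context: $\mathbb T$ is the unit circle; $\mathbb Z_+=\{0,1,2,\dots\}$; $\mu$ is quasi-definite if all Toeplitz matrices $\big(\oint_{\mathbb T}z^{i-j}d\mu\big)_{i,j=0}^n$, $n\ge0$, are non-singular. Indices start at $0$; $\dagger$ is the conjugate transpose. For a Laurent polynomial $f=\sum f_kz^k$, $\bar f(z)=\sum\overline{f_k}z^k$. Extended ordering: $\chi_{\vec n}(z)$ is the semi-infinite vector listing alternately $n_+$ increasing non-negative powers and $n_-$ decreasing negative powers of $z$: $\chi_{\vec n}=(1,z,\dots,z^{n_+-1},z^{-1},z^{-2},\dots,z^{-n_-},z^{n_+},z^{n_++1},\dots)^\top$. Put $a(l)=1$ if $\chi_{\vec n}^{(l)}$ is a non-negative power of $z$ and $a(l)=2$ if it is a negative power. For $a=1,2$,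 $l_{+a}$ (respectively $l_{-a}$) is the smallest (respectively largest) integer $l'$ with $l'\ge l$ (respectively $l'\le l$) and $a(l')=a$. $g_{\vec n}=\oint_{\mathbb T}\chi_{\vec n}(z)\chi_{\vec n}(z)^\dagger d\mu(z)=S_{\vec n,1}^{-1}S_{\vec n,2}$, with $S_{\vec n,1}$ lower triangular with unit diagonal and $S_{\vec n,2}$ upper triangular; $\varphi_{\vec n,1}^{(l)}=(S_{\vec n,1}\chi_{\vec n})^{(l)}$, $\varphi_{\vec n,2}^{(l)}=((S_{\vec n,2}^{-1})^\dagger\chi_{\vec n})^{(l)}$. $g_{\vec n}^{[l]}$ is the leading $l\times l$ block of $g_{\vec n}$, $\chi_{\vec n}^{[l]}$ the vector of the first $l$ components of $\chi_{\vec n}$, $e_j$ the canonical basis vectors. Associated Laurent polynomials ($a=1,2$): $\varphi_{\vec n,1,+a}^{(l)}=\chi_{\vec n}^{(l_{+a})}-(g_{\vec n,l_{+a},0},\dots,g_{\vec n,l_{+a},l-1})(g_{\vec n}^{[l]})^{-1}\chi_{\vec n}^{[l]}$, $\varphi_{\vec n,1,-a}^{(l)}=e_{l_{-a}}^\top(g_{\vec n}^{[l+1]})^{-1}\chi_{\vec n}^{[l+1]}$, $\varphi_{\vec n,2,+a}^{(l)}=\chi_{\vec n}^{(l_{+a})}-(\bar g_{\vec n,0,l_{+a}},\dots,\bar g_{\vec n,l-1,l_{+a}})((g_{\vec n}^{[l]})^{-1})^\dagger\chi_{\vec n}^{[l]}$, $\varphi_{\vec n,2,-a}^{(l)}=e_{l_{-a}}^\top((g_{\vec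 n}^{[l+1]})^{-1})^\dagger\chi_{\vec n}^{[l+1]}$.
   Formalization: The formula is stated for those l ≥ 1 for which the indices l_{+1}, l_{+2}, (l-1)_{-1}, (l-1)_{-2} all exist, i.e. n_+ ≥ 1, n_- ≥ 1 and l > n_+; otherwise the right-hand side is undefined. *)

theory Defs
  imports
    "HOL-Analysis.Set_Integral"
    "Jordan_Normal_Form.Determinant"
    "Jordan_Normal_Form.Gauss_Jordan_Elimination"
begin

section \<open>Complex Borel measures on the unit circle\<close>

text \<open>A complex Borel measure is a countably additive set function on the Borel sets; its values
  on other sets are irrelevant.\<close>

definition complex_borel_measure :: "(complex set \<Rightarrow> complex) \<Rightarrow> bool" where
  "complex_borel_measure \<mu> \<longleftrightarrow>
     (\<forall>A :: nat \<Rightarrow> complex set. range A \<subseteq> sets borel \<longrightarrow> disjoint_family A \<longrightarrow>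
        (\<lambda>i. \<mu> (A i)) sums \<mu> (\<Union>i. A i))"

abbreviation unit_circle :: "complex set" where
  "unit_circle \<equiv> sphere 0 1"

text \<open>The circle is closed, so the support of \<open>\<mu>\<close> lies in it iff all Borel sets off it are null.\<close>

definition supported_on_circle :: "(complex set \<Rightarrow> complex) \<Rightarrow> bool" where
  "supported_on_circle \<mu> \<longleftrightarrow> (\<forall>A \<in> sets borel. A \<inter> unit_circle = {} \<longrightarrow> \<mu> A = 0)"

text \<open>Integration is by Jordan decomposition. The positive variation of a real set function \<open>\<rho>\<close> is
  \<open>\<rho>\<^sup>+(A) = sup {\<rho>(B) | B \<subseteq> A Borel}\<close> and the negative one is \<open>(- \<rho>)\<^sup>+\<close>. The coercion \<open>ennreal\<close>
  sends negative numbers to 0, which does not change the supremum as \<open>B = {}\<close> is admitted.\<close>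

definition positive_variation :: "(complex set \<Rightarrow> real) \<Rightarrow> complex measure" where
  "positive_variation \<rho> =
     measure_of UNIV (sets borel) (\<lambda>A. SUP B \<in> {B \<in> sets borel. B \<subseteq> A}. ennreal (\<rho> B))"

definition circle_integral :: "(complex set \<Rightarrow> complex) \<Rightarrow> (complex \<Rightarrow> complex) \<Rightarrow> complex" where
  "circle_integral \<mu> f =
     (let I = (\<lambda>\<rho>. set_lebesgue_integral (positive_variation \<rho>) unit_circle f) in
       (I (\<lambda>A. Re (\<mu> A)) - I (\<lambda>A. - Re (\<mu> A))) + \<i> * (I (\<lambda>A. Im (\<mu> A)) - I (\<lambda>A. - Im (\<mu> A))))"

definition toeplitz_matrix :: "(complex set \<Rightarrow> complex) \<Rightarrow> nat \<Rightarrow> complex mat" where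
  "toeplitz_matrix \<mu> n =
     mat (n + 1) (n + 1) (\<lambda>(i, j). circle_integral \<mu> (\<lambda>z. z powi (int i - int j)))"

definition quasi_definite :: "(complex set \<Rightarrow> complex) \<Rightarrow> bool" where
  "quasi_definite \<mu> \<longleftrightarrow> (\<forall>n. det (toeplitz_matrix \<mu> n) \<noteq> 0)"

section \<open>Extended ordering of the Laurent monomials\<close>

text \<open>The monomials come in consecutive blocks of length \<open>n\<^sub>+ + n\<^sub>-\<close>. Block \<open>q\<close> consists of the
  exponents \<open>q n\<^sub>+, \<dots>, (q + 1) n\<^sub>+ - 1\<close> followed by \<open>- q n\<^sub>- - 1, \<dots>, - (q + 1) n\<^sub>-\<close>.
  The pair \<open>(0, 0)\<close>, which lists no monomial at all, yields a junk value here.\<close>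

definition chi_exponent :: "nat \<times> nat \<Rightarrow> nat \<Rightarrow> int" where
  "chi_exponent n l =
     (let q = l div (fst n + snd n); r = l mod (fst n + snd n) in
       if r < fst n then int (q * fst n + r) else - int (q * snd n + (r - fst n) + 1))"

definition chi :: "nat \<times> nat \<Rightarrow> nat \<Rightarrow> complex \<Rightarrow> complex" where
  "chi n l z = z powi chi_exponent n l"

definition chi_kind :: "nat \<times> nat \<Rightarrow> nat \<Rightarrow> nat" where
  "chi_kind n l = (if chi_exponent n l \<ge> 0 then 1 else 2)"

text \<open>These are the indices \<open>l\<^sub>+\<^sub>a\<close> and \<open>l\<^sub>-\<^sub>a\<close>, meaningful only if an index of the required
  kind exists.\<close>

definition next_index :: "nat \<times> nat \<Rightarrow> nat \<Rightarrow> nat \<Rightarrow> nat" where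
  "next_index n a l = (LEAST l'. l' \<ge> l \<and> chi_kind n l' = a)"

definition prev_index :: "nat \<times> nat \<Rightarrow> nat \<Rightarrow> nat \<Rightarrow> nat" where
  "prev_index n a l = (GREATEST l'. l' \<le> l \<and> chi_kind n l' = a)"

section \<open>Semi-infinite matrices\<close>

text \<open>Semi-infinite matrices are functions of two indices. All products and matrix-vector products
  below involve a triangular factor, so that the series have finitely many nonzero terms.\<close>

definition smat_mult ::
  "(nat \<Rightarrow> nat \<Rightarrow> complex) \<Rightarrow> (nat \<Rightarrow> nat \<Rightarrow> complex) \<Rightarrow> nat \<Rightarrow> nat \<Rightarrow> complex" where
  "smat_mult A B = (\<lambda>i j. \<Sum>k. A i k * B k j)"

definition smat_one :: "nat \<Rightarrow> nat \<Rightarrow> complex" where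
  "smat_one = (\<lambda>i j. if i = j then 1 else 0)"

definition smat_vec_mult :: "(nat \<Rightarrow> nat \<Rightarrow> complex) \<Rightarrow> (nat \<Rightarrow> complex) \<Rightarrow> nat \<Rightarrow> complex" where
  "smat_vec_mult A v = (\<lambda>i. \<Sum>k. A i k * v k)"

definition smat_dagger :: "(nat \<Rightarrow> nat \<Rightarrow> complex) \<Rightarrow> nat \<Rightarrow> nat \<Rightarrow> complex" where
  "smat_dagger A = (\<lambda>i j. cnj (A j i))"

definition lower_tri :: "(nat \<Rightarrow> nat \<Rightarrow> complex) \<Rightarrow> bool" where
  "lower_tri A \<longleftrightarrow> (\<forall>i j. i < j \<longrightarrow> A i j = 0)"

definition upper_tri :: "(nat \<Rightarrow> nat \<Rightarrow> complex) \<Rightarrow> bool" where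
  "upper_tri A \<longleftrightarrow> (\<forall>i j. j < i \<longrightarrow> A i j = 0)"

text \<open>Inverses are taken within the triangular matrices, where they are unique; among arbitrary
  semi-infinite matrices they need not be.\<close>

definition lower_inverse :: "(nat \<Rightarrow> nat \<Rightarrow> complex) \<Rightarrow> nat \<Rightarrow> nat \<Rightarrow> complex" where
  "lower_inverse A =
     (THE B. lower_tri B \<and> smat_mult A B = smat_one \<and> smat_mult B A = smat_one)"

definition upper_inverse :: "(nat \<Rightarrow> nat \<Rightarrow> complex) \<Rightarrow> nat \<Rightarrow> nat \<Rightarrow> complex" where
  "upper_inverse A =
     (THE B. upper_tri B \<and> smat_mult A B = smat_one \<and> smat_mult B A = smat_one)"

section \<open>Moment matrix, factorization and orthogonal Laurent polynomials\<close>

definition moment :: "(complex set \<Rightarrow> complex) \<Rightarrow> nat \<times> nat \<Rightarrow> nat \<Rightarrow> nat \<Rightarrow> complex" where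
  "moment \<mu> n i j = circle_integral \<mu> (\<lambda>z. chi n i z * cnj (chi n j z))"

definition gauss_borel ::
  "(nat \<Rightarrow> nat \<Rightarrow> complex) \<Rightarrow> (nat \<Rightarrow> nat \<Rightarrow> complex) \<Rightarrow> (nat \<Rightarrow> nat \<Rightarrow> complex) \<Rightarrow> bool" where
  "gauss_borel g S1 S2 \<longleftrightarrow>
     lower_tri S1 \<and> (\<forall>i. S1 i i = 1) \<and> upper_tri S2 \<and> g = smat_mult (lower_inverse S1) S2"

text \<open>For quasi-definite \<open>\<mu>\<close> the leading minors of the moment matrix do not vanish, hence the
  factorization exists and is unique.\<close>

definition gauss_factors ::
  "(complex set \<Rightarrow> complex) \<Rightarrow> nat \<times> nat \<Rightarrow> (nat \<Rightarrow> nat \<Rightarrow> complex) \<times> (nat \<Rightarrow> nat \<Rightarrow> complex)" where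
  "gauss_factors \<mu> n = (SOME S. gauss_borel (moment \<mu> n) (fst S) (snd S))"

definition phi1 :: "(complex set \<Rightarrow> complex) \<Rightarrow> nat \<times> nat \<Rightarrow> nat \<Rightarrow> complex \<Rightarrow> complex" where
  "phi1 \<mu> n l z = smat_vec_mult (fst (gauss_factors \<mu> n)) (\<lambda>k. chi n k z) l"

definition phi2 :: "(complex set \<Rightarrow> complex) \<Rightarrow> nat \<times> nat \<Rightarrow> nat \<Rightarrow> complex \<Rightarrow> complex" where
  "phi2 \<mu> n l z =
     smat_vec_mult (smat_dagger (upper_inverse (snd (gauss_factors \<mu> n)))) (\<lambda>k. chi n k z) l"

definition conj_laurent :: "(complex \<Rightarrow> complex) \<Rightarrow> complex \<Rightarrow> complex" where
  "conj_laurent f z = cnj (f (cnj z))"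

text \<open>On Laurent polynomials this is conjugation of the coefficients:\<close>

lemma conj_laurent_sum:
  "conj_laurent (\<lambda>z. \<Sum>k\<in>A. c k * z powi k) = (\<lambda>z. \<Sum>k\<in>A. cnj (c k) * z powi k)"
  by (auto simp: conj_laurent_def fun_eq_iff cnj_sum power_int_def intro!: sum.cong)

definition cd_kernel ::
  "(complex set \<Rightarrow> complex) \<Rightarrow> nat \<times> nat \<Rightarrow> nat \<Rightarrow> complex \<Rightarrow> complex \<Rightarrow> complex" where
  "cd_kernel \<mu> n l z z' = (\<Sum>k<l. phi1 \<mu> n k z' * conj_laurent (phi2 \<mu> n k) (cnj z))"

section \<open>Associated Laurent polynomials\<close>

definition moment_block :: "(complex set \<Rightarrow> complex) \<Rightarrow> nat \<times> nat \<Rightarrow> nat \<Rightarrow> complex mat" where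
  "moment_block \<mu> n l = mat l l (\<lambda>(i, j). moment \<mu> n i j)"

definition moment_block_inv :: "(complex set \<Rightarrow> complex) \<Rightarrow> nat \<times> nat \<Rightarrow> nat \<Rightarrow> complex mat" where
  "moment_block_inv \<mu> n l = the (mat_inverse (moment_block \<mu> n l))"

definition chi_block :: "nat \<times> nat \<Rightarrow> nat \<Rightarrow> complex \<Rightarrow> complex vec" where
  "chi_block n l z = vec l (\<lambda>k. chi n k z)"

definition mat_dagger :: "complex mat \<Rightarrow> complex mat" where
  "mat_dagger A = map_mat cnj (transpose_mat A)"

definition phi1_plus ::
  "(complex set \<Rightarrow> complex) \<Rightarrow> nat \<times> nat \<Rightarrow> nat \<Rightarrow> nat \<Rightarrow> complex \<Rightarrow> complex" where
  "phi1_plus \<mu> n a l z =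
     chi n (next_index n a l) z -
       scalar_prod (vec l (\<lambda>k. moment \<mu> n (next_index n a l) k))
         (moment_block_inv \<mu> n l *\<^sub>v chi_block n l z)"

definition phi1_minus ::
  "(complex set \<Rightarrow> complex) \<Rightarrow> nat \<times> nat \<Rightarrow> nat \<Rightarrow> nat \<Rightarrow> complex \<Rightarrow> complex" where
  "phi1_minus \<mu> n a l z =
     scalar_prod (unit_vec (l + 1) (prev_index n a l))
       (moment_block_inv \<mu> n (l + 1) *\<^sub>v chi_block n (l + 1) z)"

definition phi2_plus ::
  "(complex set \<Rightarrow> complex) \<Rightarrow> nat \<times> nat \<Rightarrow> nat \<Rightarrow> nat \<Rightarrow> complex \<Rightarrow> complex" where
  "phi2_plus \<mu> n a l z =
     chi n (next_index n a l) z -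
       scalar_prod (vec l (\<lambda>k. cnj (moment \<mu> n k (next_index n a l))))
         (mat_dagger (moment_block_inv \<mu> n l) *\<^sub>v chi_block n l z)"

definition phi2_minus ::
  "(complex set \<Rightarrow> complex) \<Rightarrow> nat \<times> nat \<Rightarrow> nat \<Rightarrow> nat \<Rightarrow> complex \<Rightarrow> complex" where
  "phi2_minus \<mu> n a l z =
     scalar_prod (unit_vec (l + 1) (prev_index n a l))
       (mat_dagger (moment_block_inv \<mu> n (l + 1)) *\<^sub>v chi_block n (l + 1) z)"

end

theory Submission
  imports Defs
begin

text \<open>Write \<open>e k\<close> for the exponent of the \<open>k\<close>-th monomial. On the circle the conjugate of \<open>z\<close>
  is its inverse, so the moment matrix has entries \<open>g\<^sub>i\<^sub>j = c (e i - e j)\<close>, where \<open>c m\<close> is the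
  integral of \<open>z\<^sup>m\<close>. Since the exponents \<open>e 0, \<dots>, e (l - 1)\<close> fill an integer interval
  \<open>{a..b}\<close>, the leading \<open>l \<times> l\<close> block of \<open>g\<close> is a Toeplitz matrix up to a permutation
  (\<open>det_moment_block_nonzero\<close>). Quasi-definiteness thus makes all leading blocks invertible, which
  yields the Gauss--Borel factorization (\<open>ex_gauss_borel\<close>).

  Let \<open>G\<close> be the inverse of the block. With \<open>x\<close> the conjugate of \<open>z\<close> and \<open>y = z'\<close>, let \<open>u\<close> and \<open>v\<close>
  be the vectors of the monomials \<open>x\<^bsup>e k\<^esup>\<close> and \<open>y\<^bsup>e k\<^esup>\<close>, and put \<open>p = u\<^sup>T G\<close> and \<open>q = G v\<close>.
  As \<open>G\<close> is the leading block of \<open>S2\<^sup>-\<^sup>1 S1\<close>, the kernel equals \<open>K = u\<^sup>T G v = u\<^sup>T q\<close>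
  (\<open>kernel_eq_solution\<close>). The associated polynomials of index \<open>- 2\<close> and, after conjugation, \<open>- 1\<close>
  are the entries of \<open>q\<close> and \<open>p\<close> at the positions of the extreme exponents \<open>a\<close> and \<open>b\<close>. Those of index \<open>+ 2\<close>
  and \<open>+ 1\<close> measure by how much the Toeplitz equations satisfied by \<open>p\<close> and \<open>q\<close> fail at the
  neighbouring exponents \<open>a - 1\<close> and \<open>b + 1\<close>.

  The formula then follows by moving a unit shift across the bilinear form: in
  \<open>\<Sum>\<^sub>i\<^sub>,\<^sub>k p\<^sub>i c (e i - e k + 1) q\<^sub>k\<close> the extra \<open>1\<close> can be charged to the column exponent, which
  gives \<open>K / x\<close> minus a boundary term at \<open>a - 1\<close>, or to the row exponent, which gives \<open>y K\<close> minus
  a boundary term at \<open>b + 1\<close> (\<open>toeplitz_christoffel_darboux\<close>).\<close>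

section \<open>Triangular semi-infinite matrices\<close>

text \<open>Triangularity cuts the series off at the row or column index. The freedom in \<open>l\<close> lets whole blocks be multiplied with a single common range of summation.\<close>

lemma smat_mult_lower:
  assumes "lower_tri A" "i < l"
  shows "smat_mult A B i j = (\<Sum>k<l. A i k * B k j)"
  unfolding smat_mult_def
  using assms by (intro suminf_finite) (auto simp: lower_tri_def)

lemma smat_mult_upper:
  assumes "upper_tri B" "j < l"
  shows "smat_mult A B i j = (\<Sum>k<l. A i k * B k j)"
  unfolding smat_mult_def
  using assms by (intro suminf_finite) (auto simp: upper_tri_def)

lemma smat_vec_mult_lower:
  assumes "lower_tri A" "i < l"
  shows "smat_vec_mult A v i = (\<Sum>k<l. A i k * v k)"
  unfolding smat_vec_mult_def
  using assms by (intro suminf_finite) (auto simp: lower_tri_def)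

lemma lower_tri_smat_mult:
  assumes "lower_tri A" "lower_tri B"
  shows "lower_tri (smat_mult A B)"
  unfolding lower_tri_def
proof (intro allI impI)
  fix i j :: nat assume "i < j"
  have "smat_mult A B i j = (\<Sum>k<Suc i. A i k * B k j)"
    using assms(1) by (rule smat_mult_lower) simp
  also have "\<dots> = 0"
    using assms(2) \<open>i < j\<close> by (intro sum.neutral) (auto simp: lower_tri_def)
  finally show "smat_mult A B i j = 0" .
qed

text \<open>Products of semi-infinite matrices are not associative in general; two lower triangular
  factors on the left keep all sums finite, whatever the third factor is.\<close>

lemma smat_mult_assoc_lower:
  assumes A: "lower_tri A" and B: "lower_tri B"
  shows "smat_mult (smat_mult A B) C = smat_mult A (smat_mult B C)"
proof (intro ext)
  fix i j
  have "smat_mult (smat_mult A B) C i j = (\<Sum>k<Suc i. smat_mult A B i k * C k j)"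
    by (rule smat_mult_lower[OF lower_tri_smat_mult[OF A B]]) simp
  also have "\<dots> = (\<Sum>k<Suc i. \<Sum>m<Suc i. A i m * B m k * C k j)"
    by (simp only: smat_mult_lower[OF A, of i "Suc i"] lessI sum_distrib_right)
  also have "\<dots> = (\<Sum>m<Suc i. A i m * (\<Sum>k<Suc i. B m k * C k j))"
    by (subst sum.swap) (simp only: sum_distrib_left mult.assoc)
  also have "\<dots> = (\<Sum>m<Suc i. A i m * smat_mult B C m j)"
    by (intro sum.cong refl) (simp add: smat_mult_lower[OF B, of _ "Suc i"] del: sum.lessThan_Suc)
  also have "\<dots> = smat_mult A (smat_mult B C) i j"
    by (rule smat_mult_lower[OF A, symmetric]) simp
  finally show "smat_mult (smat_mult A B) C i j = smat_mult A (smat_mult B C) i j" .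
qed

lemma lower_tri_one: "lower_tri smat_one"
  by (simp add: lower_tri_def smat_one_def)

lemma sum_smat_one:
  assumes "i < l"
  shows "(\<Sum>k<l. smat_one i k * f k) = f i" "(\<Sum>k<l. f k * smat_one k i) = f i"
proof -
  have "(\<Sum>k<l. smat_one i k * f k) = (\<Sum>k<l. if i = k then f k else 0)"
    "(\<Sum>k<l. f k * smat_one k i) = (\<Sum>k<l. if i = k then f k else 0)"
    by (intro sum.cong; auto simp: smat_one_def)+
  then show "(\<Sum>k<l. smat_one i k * f k) = f i" "(\<Sum>k<l. f k * smat_one k i) = f i"
    using assms by simp_all
qed

lemma smat_one_mult: "smat_mult smat_one A = A"
proof (intro ext)
  fix i j
  have "smat_mult smat_one A i j = (\<Sum>k<Suc i. smat_one i k * A k j)"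
    by (rule smat_mult_lower[OF lower_tri_one]) simp
  then show "smat_mult smat_one A i j = A i j"
    by (simp only: sum_smat_one lessI)
qed

lemma smat_mult_one_lower:
  assumes "lower_tri A"
  shows "smat_mult A smat_one = A"
proof (intro ext)
  fix i j
  have "smat_mult A smat_one i j = (\<Sum>k<Suc (max i j). A i k * smat_one k j)"
    by (rule smat_mult_lower[OF assms]) simp
  also have "\<dots> = A i j" by (rule sum_smat_one) simp
  finally show "smat_mult A smat_one i j = A i j" .
qed

lemma smat_mult_transpose:
  "smat_mult (\<lambda>i j. B j i) (\<lambda>i j. A j i) i j = smat_mult A B j i"
  by (simp add: smat_mult_def mult.commute)

text \<open>Forward substitution: column \<open>j\<close> of the inverse solves the triangular system with
  right-hand side \<open>e\<^sub>j\<close>.\<close>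

fun forward_subst :: "(nat \<Rightarrow> nat \<Rightarrow> complex) \<Rightarrow> nat \<Rightarrow> nat \<Rightarrow> complex" where
  "forward_subst A i j =
     (if i < j then 0 else (smat_one i j - (\<Sum>k<i. A i k * forward_subst A k j)) / A i i)"

declare forward_subst.simps [simp del]

lemma lower_tri_forward_subst: "lower_tri (forward_subst A)"
  by (simp add: lower_tri_def forward_subst.simps)

lemma smat_mult_forward_subst:
  assumes A: "lower_tri A" and nz: "\<And>i. A i i \<noteq> 0"
  shows "smat_mult A (forward_subst A) = smat_one"
proof (intro ext)
  fix i j
  have eq: "smat_mult A (forward_subst A) i j =
      (\<Sum>k<i. A i k * forward_subst A k j) + A i i * forward_subst A i j"
    using smat_mult_lower[OF A, of i "Suc i"] by simp
  show "smat_mult A (forward_subst A) i j = smat_one i j"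
  proof (cases "i < j")
    case True
    then have "(\<Sum>k<i. A i k * forward_subst A k j) = 0"
      by (intro sum.neutral) (auto simp: forward_subst.simps)
    then show ?thesis
      using True by (simp add: eq smat_one_def forward_subst.simps)
  next
    case False
    then show ?thesis
      unfolding eq using nz[of i] by (subst (2) forward_subst.simps) simp
  qed
qed

text \<open>A right inverse of a lower triangular matrix has itself a right inverse, so by associativity
  both are two-sided, as in any monoid in which every element has a right inverse.\<close>

lemma ex1_lower_inverse:
  assumes A: "lower_tri A" and nz: "\<And>i. A i i \<noteq> 0"
  shows "\<exists>!B. lower_tri B \<and> smat_mult A B = smat_one \<and> smat_mult B A = smat_one"
proof (rule ex_ex1I)
  let ?B = "forward_subst A"
  let ?C = "forward_subst ?B"
  have B: "lower_tri ?B" by (rule lower_tri_forward_subst)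
  have AB: "smat_mult A ?B = smat_one" by (rule smat_mult_forward_subst[OF A nz])
  have "?B i i \<noteq> 0" for i
  proof -
    have "(\<Sum>k<i. A i k * ?B k i) = 0"
      by (intro sum.neutral) (auto simp: forward_subst.simps)
    then show ?thesis
      using nz[of i] by (subst forward_subst.simps) (simp add: smat_one_def)
  qed
  then have BC: "smat_mult ?B ?C = smat_one" by (rule smat_mult_forward_subst[OF B])
  have "?C = smat_mult (smat_mult A ?B) ?C" by (simp add: AB smat_one_mult)
  also have "\<dots> = A" by (simp add: smat_mult_assoc_lower[OF A B] BC smat_mult_one_lower[OF A])
  finally show "\<exists>B. lower_tri B \<and> smat_mult A B = smat_one \<and> smat_mult B A = smat_one"
    using B AB BC by auto
next
  fix B B'
  assume B: "lower_tri B \<and> smat_mult A B = smat_one \<and> smat_mult B A = smat_one"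
    and B': "lower_tri B' \<and> smat_mult A B' = smat_one \<and> smat_mult B' A = smat_one"
  have "B = smat_mult B (smat_mult A B')"
    using B B' by (simp add: smat_mult_one_lower)
  also have "\<dots> = smat_mult (smat_mult B A) B'"
    by (rule smat_mult_assoc_lower[OF conjunct1[OF B] A, symmetric])
  also have "\<dots> = B'"
    using B by (simp add: smat_one_mult)
  finally show "B = B'" .
qed

lemma lower_inverse:
  assumes "lower_tri A" "\<And>i. A i i \<noteq> 0"
  shows "lower_tri (lower_inverse A)" "smat_mult A (lower_inverse A) = smat_one"
    "smat_mult (lower_inverse A) A = smat_one"
  using theI'[OF ex1_lower_inverse[OF assms]] unfolding lower_inverse_def by auto

text \<open>Transposition turns upper into lower triangular matrices and reverses products.\<close>

lemma ex1_upper_inverse: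
  assumes A: "upper_tri A" and nz: "\<And>i. A i i \<noteq> 0"
  shows "\<exists>!B. upper_tri B \<and> smat_mult A B = smat_one \<and> smat_mult B A = smat_one"
proof -
  let ?T = "\<lambda>(X :: nat \<Rightarrow> nat \<Rightarrow> complex) i j. X j i"
  have tr: "smat_mult (?T X) (?T Y) = smat_one \<longleftrightarrow> smat_mult Y X = smat_one" for X Y
  proof -
    have "smat_one i j = smat_one j i" for i j by (simp add: smat_one_def)
    then show ?thesis using smat_mult_transpose[of X Y] unfolding fun_eq_iff by metis
  qed
  have tri: "lower_tri (?T X) \<longleftrightarrow> upper_tri X" for X
    by (auto simp: lower_tri_def upper_tri_def)
  define P where "P B \<longleftrightarrow> lower_tri B \<and> smat_mult (?T A) B = smat_one \<and>
    smat_mult B (?T A) = smat_one" for B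
  define Q where "Q C \<longleftrightarrow> upper_tri C \<and> smat_mult A C = smat_one \<and>
    smat_mult C A = smat_one" for C
  have key: "Q C \<longleftrightarrow> P (?T C)" for C
    unfolding P_def Q_def using tri[of C] tr[of A C] tr[of C A] by argo
  have "lower_tri (?T A)" using A tri[of A] by (rule iffD2[rotated])
  then have ex1: "\<exists>!B. P B"
    unfolding P_def using nz by (rule ex1_lower_inverse)
  then obtain B where B: "P B" by (rule ex1E)
  have "Q (?T B)" using key[of "?T B"] B by simp
  moreover have "C = ?T B" if "Q C" for C
  proof -
    have "?T C = B" using ex1 B key[of C] that by blast
    then show ?thesis by (simp only: flip: \<open>?T C = B\<close>)
  qed
  ultimately have "\<exists>!C. Q C" by (rule ex1I)
  then show ?thesis unfolding Q_def .
qed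

lemma upper_inverse:
  assumes "upper_tri A" "\<And>i. A i i \<noteq> 0"
  shows "upper_tri (upper_inverse A)" "smat_mult (upper_inverse A) A = smat_one"
  using theI'[OF ex1_upper_inverse[OF assms]] unfolding upper_inverse_def by auto

section \<open>Gauss--Borel factorization and the kernel as an inverse matrix\<close>

definition block_inverse ::
  "(nat \<Rightarrow> nat \<Rightarrow> complex) \<Rightarrow> nat \<Rightarrow> (nat \<Rightarrow> nat \<Rightarrow> complex) \<Rightarrow> bool" where
  "block_inverse g l H \<longleftrightarrow> (\<forall>i<l. \<forall>j<l.
     (\<Sum>k<l. g i k * H k j) = smat_one i j \<and> (\<Sum>k<l. H i k * g k j) = smat_one i j)"

lemma sum_mult_sum_assoc:
  fixes f :: "'a \<Rightarrow> complex"
  shows "(\<Sum>k\<in>A. (\<Sum>i\<in>B. f i * g i k) * h k) = (\<Sum>i\<in>B. f i * (\<Sum>k\<in>A. g i k * h k))"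
  by (simp only: sum_distrib_left sum_distrib_right mult.assoc) (rule sum.swap)

text \<open>If \<open>H\<close> inverts the leading \<open>i \<times> i\<close> block of \<open>g\<close>, row \<open>i\<close> of \<open>S1\<close> can be taken as
  \<open>(- v, 1)\<close> with the row vector \<open>v = (g\<^sub>i\<^sub>0, \<dots>, g\<^sub>i\<^sub>,\<^sub>i\<^sub>-\<^sub>1) H\<close>,
  which expresses the first \<open>i\<close> entries of row \<open>i\<close> of \<open>g\<close> as a combination of the rows above; this clears them, so \<open>S1 g\<close> is upper triangular.\<close>

lemma ex_gauss_borel:
  assumes inv: "\<And>l. \<exists>H. block_inverse g l H"
  shows "\<exists>S. gauss_borel g (fst S) (snd S)"
proof -
  obtain H where H: "\<And>l. block_inverse g l (H l)"
    using inv by metis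
  define S1 where "S1 = (\<lambda>i j. if i < j then 0 else if i = j then 1 else
    - (\<Sum>k<i. g i k * H i k j))"
  have low: "lower_tri S1" and diag: "\<And>i. S1 i i = 1"
    by (simp_all add: S1_def lower_tri_def)
  have "upper_tri (smat_mult S1 g)"
    unfolding upper_tri_def
  proof (intro allI impI)
    fix i j :: nat assume "j < i"
    have "(\<Sum>m<i. (\<Sum>k<i. g i k * H i k m) * g m j) = (\<Sum>k<i. g i k * (\<Sum>m<i. H i k m * g m j))"
      by (rule sum_mult_sum_assoc)
    also have "\<dots> = (\<Sum>k<i. g i k * smat_one k j)"
      using H[of i] \<open>j < i\<close> by (intro sum.cong refl) (simp add: block_inverse_def)
    also have "\<dots> = g i j" using \<open>j < i\<close> by (rule sum_smat_one)
    finally have 1: "(\<Sum>m<i. (\<Sum>k<i. g i k * H i k m) * g m j) = g i j" .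
    have "smat_mult S1 g i j = (\<Sum>m<i. S1 i m * g m j) + g i j"
      using smat_mult_lower[OF low, of i "Suc i"] diag by simp
    also have "(\<Sum>m<i. S1 i m * g m j) = - (\<Sum>m<i. (\<Sum>k<i. g i k * H i k m) * g m j)"
      unfolding sum_negf[symmetric] by (intro sum.cong refl) (simp add: S1_def)
    finally show "smat_mult S1 g i j = 0" using 1 by simp
  qed
  moreover have "g = smat_mult (lower_inverse S1) (smat_mult S1 g)"
    using lower_inverse[OF low] low diag
    by (simp add: smat_mult_assoc_lower[symmetric] smat_one_mult)
  ultimately have "gauss_borel g S1 (smat_mult S1 g)"
    using low diag by (simp add: gauss_borel_def)
  then show ?thesis by auto
qed

lemma gauss_borel_mult:
  assumes "gauss_borel g S1 S2"
  shows "smat_mult S1 g = S2"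
proof -
  have S1: "lower_tri S1" and nz: "\<And>i. S1 i i \<noteq> 0"
    and g: "g = smat_mult (lower_inverse S1) S2"
    using assms by (auto simp: gauss_borel_def)
  have "smat_mult S1 g = smat_mult (smat_mult S1 (lower_inverse S1)) S2"
    by (subst g) (simp add: smat_mult_assoc_lower[OF S1 lower_inverse(1)[OF S1 nz]])
  then show ?thesis by (simp add: lower_inverse(2)[OF S1 nz] smat_one_mult)
qed

text \<open>If a diagonal entry of \<open>S2 = S1 g\<close> vanished, the corresponding row of \<open>S1\<close> would be a nonzero
  left null vector of a leading block of \<open>g\<close>.\<close>

lemma gauss_borel_diag_nonzero:
  assumes gb: "gauss_borel g S1 S2" and inv: "block_inverse g (Suc i) H"
  shows "S2 i i \<noteq> 0"
proof
  assume z: "S2 i i = 0"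
  have S1: "lower_tri S1" and S2: "upper_tri S2" and one: "S1 i i = 1"
    using gb by (auto simp: gauss_borel_def)
  have 0: "(\<Sum>k<Suc i. S1 i k * g k j) = 0" if "j < Suc i" for j
  proof -
    have "(\<Sum>k<Suc i. S1 i k * g k j) = smat_mult S1 g i j"
      by (rule smat_mult_lower[OF S1, symmetric]) simp
    also have "\<dots> = S2 i j" by (simp add: gauss_borel_mult[OF gb])
    also have "\<dots> = 0" using z S2 that by (cases "j = i") (auto simp: upper_tri_def)
    finally show ?thesis .
  qed
  have "S1 i i = (\<Sum>k<Suc i. S1 i k * smat_one k i)"
    by (rule sum_smat_one(2)[symmetric]) simp
  also have "\<dots> = (\<Sum>k<Suc i. S1 i k * (\<Sum>j<Suc i. g k j * H j i))"
    using inv unfolding block_inverse_def by (intro sum.cong refl) (metis lessThan_iff lessI)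
  also have "\<dots> = (\<Sum>j<Suc i. (\<Sum>k<Suc i. S1 i k * g k j) * H j i)"
    by (rule sum_mult_sum_assoc[symmetric])
  also have "\<dots> = 0"
    using 0 by (intro sum.neutral) (simp del: sum.lessThan_Suc)
  finally show False using one by simp
qed

text \<open>On the leading block \<open>S2\<^sup>-\<^sup>1 S1\<close> is the inverse of \<open>g\<close>: applying \<open>S1\<close> to \<open>g q = v\<close>
  gives \<open>S2 q = S1 v\<close>. So the kernel, which is \<open>u\<^sup>T S2\<^sup>-\<^sup>1 S1 v\<close> truncated to the block, is
  \<open>u\<^sup>T q\<close>; triangularity makes truncation compatible with the products.\<close>

lemma kernel_eq_solution:
  assumes gb: "gauss_borel g S1 S2" and nz: "\<And>i. S2 i i \<noteq> 0"
    and q: "\<And>i. i < l \<Longrightarrow> (\<Sum>k<l. g i k * q k) = v i"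
  shows "(\<Sum>k<l. smat_vec_mult S1 v k * (\<Sum>i<l. u i * upper_inverse S2 i k)) = (\<Sum>i<l. u i * q i)"
proof -
  have S1: "lower_tri S1" and S2: "upper_tri S2"
    using gb by (auto simp: gauss_borel_def)
  let ?U = "upper_inverse S2"
  have S1v: "smat_vec_mult S1 v k = (\<Sum>i<l. S2 k i * q i)" if "k < l" for k
  proof -
    have "smat_vec_mult S1 v k = (\<Sum>j<l. S1 k j * (\<Sum>i<l. g j i * q i))"
      unfolding smat_vec_mult_lower[OF S1 that] using q by (intro sum.cong refl) simp
    also have "\<dots> = (\<Sum>i<l. (\<Sum>j<l. S1 k j * g j i) * q i)"
      by (rule sum_mult_sum_assoc[symmetric])
    also have "\<dots> = (\<Sum>i<l. S2 k i * q i)"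
      unfolding smat_mult_lower[OF S1 that, symmetric] gauss_borel_mult[OF gb] ..
    finally show ?thesis .
  qed
  have US: "(\<Sum>k<l. ?U i k * S2 k m) = smat_one i m" if "m < l" for i m
    unfolding smat_mult_upper[OF S2 that, symmetric] upper_inverse(2)[OF S2 nz] ..
  have "(\<Sum>k<l. smat_vec_mult S1 v k * (\<Sum>i<l. u i * ?U i k)) =
      (\<Sum>k<l. (\<Sum>i<l. u i * ?U i k) * (\<Sum>m<l. S2 k m * q m))"
    by (intro sum.cong refl) (simp add: S1v mult.commute)
  also have "\<dots> = (\<Sum>i<l. u i * (\<Sum>k<l. ?U i k * (\<Sum>m<l. S2 k m * q m)))"
    by (rule sum_mult_sum_assoc)
  also have "\<dots> = (\<Sum>i<l. u i * (\<Sum>m<l. (\<Sum>k<l. ?U i k * S2 k m) * q m))"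
    by (simp only: sum_mult_sum_assoc)
  also have "\<dots> = (\<Sum>i<l. u i * q i)"
    by (intro sum.cong refl) (simp add: US sum_smat_one)
  finally show ?thesis .
qed

section \<open>A Christoffel--Darboux identity for Toeplitz systems\<close>

text \<open>The Toeplitz systems for \<open>p\<close> and \<open>q\<close> say that \<open>F\<close> and \<open>E\<close> below agree with the powers of
  \<open>x\<close> and \<open>y\<close> on \<open>{a..b}\<close>. A unit shift keeps all exponents in \<open>{a..b}\<close> except an
  extreme one, and its single term produces a product in the numerator of the formula.
  Only the set of exponents matters, so they may be listed in any order.\<close>

lemma toeplitz_christoffel_darboux:
  fixes e :: "nat \<Rightarrow> int" and c :: "int \<Rightarrow> complex" and p q :: "nat \<Rightarrow> complex"
  assumes bij: "bij_betw e {..<l} {a..b}"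
    and p: "\<And>j. j < l \<Longrightarrow> (\<Sum>k<l. p k * c (e k - e j)) = x powi e j"
    and q: "\<And>i. i < l \<Longrightarrow> (\<Sum>k<l. c (e i - e k) * q k) = y powi e i"
    and r: "r < l" "e r = a" and s: "s < l" "e s = b"
    and nz: "x \<noteq> 0" "y \<noteq> 0"
  shows "(1 - y * x) * (\<Sum>k<l. x powi e k * q k) =
    x * (x powi (a - 1) - (\<Sum>k<l. p k * c (e k - (a - 1)))) * q r -
    (y powi (b + 1) - (\<Sum>k<l. c (b + 1 - e k) * q k)) * x * p s"
proof -
  define F where "F t = (\<Sum>k<l. p k * c (e k - t))" for t
  define E where "E t = (\<Sum>k<l. c (t - e k) * q k)" for t
  define K where "K = (\<Sum>k<l. x powi e k * q k)"
  have inj: "e i = e j \<longleftrightarrow> i = j" if "i < l" "j < l" for i j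
    using bij_betw_imp_inj_on[OF bij] that by (auto simp: inj_on_eq_iff)
  have mem: "e k \<in> {a..b}" if "k < l" for k
    using bij_betwE[OF bij] that by auto
  have F_in: "F t = x powi t" and E_in: "E t = y powi t" if "t \<in> {a..b}" for t
  proof -
    have "t \<in> e ` {..<l}"
      using that unfolding bij_betw_imp_surj_on[OF bij] .
    then obtain i where i: "i < l" "t = e i" by auto
    show "F t = x powi t" "E t = y powi t"
      unfolding F_def E_def i(2) by (rule p[OF i(1)], rule q[OF i(1)])
  qed
  have swap: "(\<Sum>k<l. F (e k - d) * q k) = (\<Sum>k<l. p k * E (e k + d))" for d
    unfolding F_def E_def sum_mult_sum_assoc by (simp only: diff_diff_eq2)
  (* With shift 0 there is no boundary term, and the same exchange shows that K is symmetric in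
     the roles of (x, q) and (y, p). *)
  have K': "K = (\<Sum>k<l. p k * y powi e k)"
  proof -
    have "K = (\<Sum>k<l. F (e k - 0) * q k)"
      unfolding K_def using mem F_in by (intro sum.cong) auto
    also have "\<dots> = (\<Sum>k<l. p k * y powi e k)"
      unfolding swap using mem E_in by (intro sum.cong) auto
    finally show ?thesis .
  qed
  have "(\<Sum>k<l. F (e k - 1) * q k) =
      (\<Sum>k<l. x powi (e k - 1) * q k - (if r = k then (x powi (a - 1) - F (a - 1)) * q r else 0))"
  proof (intro sum.cong refl)
    fix k assume "k \<in> {..<l}"
    show "F (e k - 1) * q k =
      x powi (e k - 1) * q k - (if r = k then (x powi (a - 1) - F (a - 1)) * q r else 0)"
    proof (cases "r = k")
      case True
      then show ?thesis using r by (simp add: algebra_simps)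
    next
      case False
      then have "e k \<noteq> a" using inj[of r k] r \<open>k \<in> {..<l}\<close> by auto
      then have "e k - 1 \<in> {a..b}" using mem[of k] \<open>k \<in> {..<l}\<close> by auto
      then show ?thesis using False by (simp add: F_in)
    qed
  qed
  also have "\<dots> = K / x - (x powi (a - 1) - F (a - 1)) * q r"
    using r nz by (simp add: sum_subtractf K_def sum_divide_distrib power_int_diff)
  finally have 1: "(\<Sum>k<l. F (e k - 1) * q k) = K / x - (x powi (a - 1) - F (a - 1)) * q r" .
  have "(\<Sum>k<l. p k * E (e k + 1)) =
      (\<Sum>k<l. p k * y powi (e k + 1) - (if s = k then p s * (y powi (b + 1) - E (b + 1)) else 0))"
  proof (intro sum.cong refl)
    fix k assume "k \<in> {..<l}"
    show "p k * E (e k + 1) =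
      p k * y powi (e k + 1) - (if s = k then p s * (y powi (b + 1) - E (b + 1)) else 0)"
    proof (cases "s = k")
      case True
      then show ?thesis using s by (simp add: algebra_simps)
    next
      case False
      then have "e k \<noteq> b" using inj[of s k] s \<open>k \<in> {..<l}\<close> by auto
      then have "e k + 1 \<in> {a..b}" using mem[of k] \<open>k \<in> {..<l}\<close> by auto
      then show ?thesis using False by (simp add: E_in)
    qed
  qed
  also have "\<dots> = y * K - p s * (y powi (b + 1) - E (b + 1))"
    using s nz by (simp add: sum_subtractf K' sum_distrib_left power_int_add mult_ac)
  finally have 2: "(\<Sum>k<l. p k * E (e k + 1)) = y * K - p s * (y powi (b + 1) - E (b + 1))" .
  have "K / x - (x powi (a - 1) - F (a - 1)) * q r = y * K - p s * (y powi (b + 1) - E (b + 1))"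
    using swap[of 1] 1 2 by simp
  then have "x * (K / x) - x * ((x powi (a - 1) - F (a - 1)) * q r) =
      x * (y * K - p s * (y powi (b + 1) - E (b + 1)))"
    by (metis right_diff_distrib)
  then show ?thesis
    using nz(1) unfolding K_def[symmetric] F_def[symmetric] E_def[symmetric]
    by (simp add: algebra_simps)
qed

section \<open>The extended ordering\<close>

definition nonneg_count :: "nat \<times> nat \<Rightarrow> nat \<Rightarrow> nat" where
  "nonneg_count n l = card {k. k < l \<and> chi_kind n k = 1}"

definition neg_count :: "nat \<times> nat \<Rightarrow> nat \<Rightarrow> nat" where
  "neg_count n l = card {k. k < l \<and> chi_kind n k = 2}"

lemma chi_kind_cases: "chi_kind n k = 1 \<or> chi_kind n k = 2"
  by (simp add: chi_kind_def)

lemma chi_kind_iff: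
  "chi_kind n k = 1 \<longleftrightarrow> k mod (fst n + snd n) < fst n"
  "chi_kind n k = 2 \<longleftrightarrow> \<not> k mod (fst n + snd n) < fst n"
proof -
  have "chi_exponent n k \<ge> 0 \<longleftrightarrow> k mod (fst n + snd n) < fst n"
    unfolding chi_exponent_def Let_def by (simp del: of_nat_add of_nat_mult of_nat_diff)
  then show "chi_kind n k = 1 \<longleftrightarrow> k mod (fst n + snd n) < fst n"
    "chi_kind n k = 2 \<longleftrightarrow> \<not> k mod (fst n + snd n) < fst n"
    by (simp_all add: chi_kind_def)
qed

text \<open>The pair \<open>(0, 0)\<close> is excluded because division by zero makes all its exponents negative.\<close>

lemma both_kinds_imp_pos:
  assumes "chi_kind n k = 1" "chi_kind n k' = 2"
  shows "fst n > 0" "snd n > 0"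
proof -
  show "fst n > 0" using assms(1) chi_kind_iff(1)[of n k] by simp
  show "snd n > 0"
    using assms chi_kind_iff[of n] by (cases "snd n = 0"; cases "fst n = 0") auto
qed

lemma count_Suc:
  "nonneg_count n (Suc l) = nonneg_count n l + (if chi_kind n l = 1 then 1 else 0)"
  "neg_count n (Suc l) = neg_count n l + (if chi_kind n l = 2 then 1 else 0)"
proof -
  have *: "{k. k < Suc l \<and> P k} = (if P l then insert l {k. k < l \<and> P k} else {k. k < l \<and> P k})"
    for P by (auto simp: less_Suc_eq)
  show "nonneg_count n (Suc l) = nonneg_count n l + (if chi_kind n l = 1 then 1 else 0)"
    "neg_count n (Suc l) = neg_count n l + (if chi_kind n l = 2 then 1 else 0)"
    by (simp_all add: nonneg_count_def neg_count_def *)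
qed

lemma count_0: "nonneg_count n 0 = 0" "neg_count n 0 = 0"
  by (simp_all add: nonneg_count_def neg_count_def)

lemma count_eq:
  assumes "fst n > 0" "snd n > 0"
  shows "nonneg_count n l =
      (l div (fst n + snd n)) * fst n + min (l mod (fst n + snd n)) (fst n) \<and>
    neg_count n l =
      (l div (fst n + snd n)) * snd n + (l mod (fst n + snd n) - fst n)"
proof (induction l)
  case 0
  then show ?case by (simp add: count_0)
next
  case (Suc l)
  have "l mod (fst n + snd n) < fst n + snd n" using assms by simp
  then show ?case
    using assms Suc unfolding count_Suc chi_kind_iff
    by (auto simp: div_Suc mod_Suc min_def)
qed

text \<open>The exponent at position \<open>l\<close> is the next unused one of its kind. This replaces the block
  arithmetic by a description that only refers to the preceding monomials.\<close>

lemma chi_exponent_eq_count: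
  assumes "fst n > 0" "snd n > 0"
  shows "chi_exponent n l =
    (if chi_kind n l = 1 then int (nonneg_count n l) else - int (neg_count n l) - 1)"
  unfolding conjunct1[OF count_eq[OF assms]] conjunct2[OF count_eq[OF assms]] chi_kind_iff
  by (simp add: chi_exponent_def Let_def)

lemma bij_betw_chi_exponent:
  assumes "fst n > 0" "snd n > 0"
  shows "bij_betw (chi_exponent n) {..<l} {- int (neg_count n l) .. int (nonneg_count n l) - 1}"
proof (induction l)
  case 0
  then show ?case by (simp add: count_0 bij_betw_def)
next
  case (Suc l)
  let ?I = "\<lambda>l. {- int (neg_count n l) .. int (nonneg_count n l) - 1}"
  have "chi_exponent n l \<notin> ?I l" "?I (Suc l) = insert (chi_exponent n l) (?I l)"
    using chi_kind_cases[of n l] by (auto simp: chi_exponent_eq_count[OF assms] count_Suc)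
  moreover have "{..<Suc l} = insert l {..<l}" by auto
  ultimately show ?case
    using bij_betw_combine[OF Suc, of "{l}" "{chi_exponent n l}"]
    by (simp add: bij_betw_def)
qed

lemma count_add: "nonneg_count n l + neg_count n l = l"
proof (induction l)
  case (Suc l)
  then show ?case using chi_kind_cases[of n l] by (auto simp: count_Suc)
qed (simp add: count_0)

text \<open>A stretch without monomials of kind \<open>a\<close> leaves their count unchanged. Such stretches lead from
  \<open>l\<close> up to \<open>l\<^sub>+\<^sub>a\<close>, and from just after \<open>(l - 1)\<^sub>-\<^sub>a\<close> up to \<open>l\<close>; this determines the
  exponents at these two indices.\<close>

lemma count_constant:
  assumes "m \<le> k" "\<And>i. m \<le> i \<Longrightarrow> i < k \<Longrightarrow> chi_kind n i \<noteq> a"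
  shows "a = 1 \<Longrightarrow> nonneg_count n k = nonneg_count n m"
    "a = 2 \<Longrightarrow> neg_count n k = neg_count n m"
  using assms by (induction k rule: dec_induct) (auto simp: count_Suc)

lemma next_index:
  assumes "\<exists>k\<ge>l. chi_kind n k = a"
  shows "next_index n a l \<ge> l" "chi_kind n (next_index n a l) = a"
    "\<And>i. l \<le> i \<Longrightarrow> i < next_index n a l \<Longrightarrow> chi_kind n i \<noteq> a"
proof -
  show "next_index n a l \<ge> l" "chi_kind n (next_index n a l) = a"
    using LeastI_ex[OF assms] unfolding next_index_def by simp_all
  show "chi_kind n i \<noteq> a" if "l \<le> i" "i < next_index n a l" for i
    using not_less_Least[of i "\<lambda>k. k \<ge> l \<and> chi_kind n k = a"] that
    unfolding next_index_def by simp
qed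

lemma prev_index:
  assumes "\<exists>k\<le>l. chi_kind n k = a"
  shows "prev_index n a l \<le> l" "chi_kind n (prev_index n a l) = a"
    "\<And>i. prev_index n a l < i \<Longrightarrow> i \<le> l \<Longrightarrow> chi_kind n i \<noteq> a"
proof -
  let ?P = "\<lambda>k. k \<le> l \<and> chi_kind n k = a"
  show "prev_index n a l \<le> l" "chi_kind n (prev_index n a l) = a"
    using GreatestI_ex_nat[OF assms, of l] unfolding prev_index_def by auto
  show "chi_kind n i \<noteq> a" if "prev_index n a l < i" "i \<le> l" for i
    using Greatest_le_nat[of ?P i l] that unfolding prev_index_def by auto
qed

lemma chi_exponent_next_index:
  assumes n: "fst n > 0" "snd n > 0"
  shows "\<exists>k\<ge>l. chi_kind n k = 1 \<Longrightarrow> chi_exponent n (next_index n 1 l) = int (nonneg_count n l)"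
    "\<exists>k\<ge>l. chi_kind n k = 2 \<Longrightarrow> chi_exponent n (next_index n 2 l) = - int (neg_count n l) - 1"
proof -
  assume "\<exists>k\<ge>l. chi_kind n k = 1"
  note idx = next_index[OF this]
  then have "nonneg_count n (next_index n 1 l) = nonneg_count n l"
    by (intro count_constant(1)[OF idx(1), of n 1]) simp_all
  then show "chi_exponent n (next_index n 1 l) = int (nonneg_count n l)"
    using idx(2) by (simp add: chi_exponent_eq_count[OF n])
next
  assume "\<exists>k\<ge>l. chi_kind n k = 2"
  note idx = next_index[OF this]
  then have "neg_count n (next_index n 2 l) = neg_count n l"
    by (intro count_constant(2)[OF idx(1), of n 2]) simp_all
  then show "chi_exponent n (next_index n 2 l) = - int (neg_count n l) - 1"
    using idx(2) by (simp add: chi_exponent_eq_count[OF n])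
qed

lemma chi_exponent_prev_index:
  assumes "fst n > 0" "snd n > 0" "l > 0"
  shows "\<exists>k\<le>l-1. chi_kind n k = 1 \<Longrightarrow>
      chi_exponent n (prev_index n 1 (l - 1)) = int (nonneg_count n l) - 1"
    "\<exists>k\<le>l-1. chi_kind n k = 2 \<Longrightarrow>
      chi_exponent n (prev_index n 2 (l - 1)) = - int (neg_count n l)"
proof -
  { fix a assume ex: "\<exists>k\<le>l-1. chi_kind n k = a"
    let ?r = "prev_index n a (l - 1)"
    have r: "Suc ?r \<le> l" "chi_kind n ?r = a"
      and no: "\<And>i. Suc ?r \<le> i \<Longrightarrow> i < l \<Longrightarrow> chi_kind n i \<noteq> a"
      using prev_index[OF ex] \<open>l > 0\<close> by auto
    have "nonneg_count n l = nonneg_count n ?r + 1" if "a = 1"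
      using count_constant(1)[OF r(1) no that] r(2) that by (simp add: count_Suc)
    moreover have "neg_count n l = neg_count n ?r + 1" if "a = 2"
      using count_constant(2)[OF r(1) no that] r(2) that by (simp add: count_Suc)
    moreover note r(2)
    ultimately have "a = 1 \<Longrightarrow> nonneg_count n l = nonneg_count n ?r + 1"
      "a = 2 \<Longrightarrow> neg_count n l = neg_count n ?r + 1" "chi_kind n ?r = a"
      by blast+ }
  note * = this
  show "\<exists>k\<le>l-1. chi_kind n k = 1 \<Longrightarrow>
      chi_exponent n (prev_index n 1 (l - 1)) = int (nonneg_count n l) - 1"
    using *(1,3)[of 1] by (simp add: chi_exponent_eq_count[OF assms(1,2)])
  show "\<exists>k\<le>l-1. chi_kind n k = 2 \<Longrightarrow>
      chi_exponent n (prev_index n 2 (l - 1)) = - int (neg_count n l)"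
    using *(2,3)[of 2] by (simp add: chi_exponent_eq_count[OF assms(1,2)])
qed

section \<open>Moments of the measure\<close>

definition circle_moment :: "(complex set \<Rightarrow> complex) \<Rightarrow> int \<Rightarrow> complex" where
  "circle_moment \<mu> k = circle_integral \<mu> (\<lambda>z. z powi k)"

lemma circle_integral_cong:
  assumes "\<And>z. z \<in> unit_circle \<Longrightarrow> f z = g z"
  shows "circle_integral \<mu> f = circle_integral \<mu> g"
proof -
  have "(\<lambda>z. indicator unit_circle z *\<^sub>R f z) = (\<lambda>z. indicator unit_circle z *\<^sub>R g z)"
    using assms by (auto simp: indicator_def fun_eq_iff)
  then show ?thesis
    by (simp add: circle_integral_def set_lebesgue_integral_def)
qed

lemma moment_eq: "moment \<mu> n i j = circle_moment \<mu> (chi_exponent n i - chi_exponent n j)"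
  unfolding moment_def circle_moment_def
proof (rule circle_integral_cong)
  fix z :: complex assume "z \<in> unit_circle"
  then have "norm z = 1" by simp
  then have "z \<noteq> 0" and "z * cnj z = 1"
    using complex_norm_square[of z] by auto
  have "cnj z = inverse z"
    using inverse_unique[OF \<open>z * cnj z = 1\<close>] by (rule sym)
  then show "chi n i z * cnj (chi n j z) = z powi (chi_exponent n i - chi_exponent n j)"
    using \<open>z \<noteq> 0\<close> by (simp add: chi_def power_int_diff power_int_inverse divide_inverse)
qed

text \<open>The first \<open>l\<close> monomials have consecutive exponents, so up to a common permutation of rows
  and columns the leading block is a Toeplitz matrix, and a null vector of one gives a null vector
  of the other.\<close>

lemma det_moment_block_nonzero:
  assumes qd: "quasi_definite \<mu>" and n: "fst n > 0" "snd n > 0"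
  shows "det (moment_block \<mu> n l) \<noteq> 0"
proof (cases l)
  case 0
  then show ?thesis by (simp add: moment_block_def)
next
  case (Suc m)
  let ?A = "moment_block \<mu> n l" and ?T = "toeplitz_matrix \<mu> m"
  (* The permutation sends the k-th exponent to its rank in increasing order. *)
  define \<sigma> where "\<sigma> k = nat (chi_exponent n k + int (neg_count n l))" for k
  have bij_e: "bij_betw (chi_exponent n) {..<l}
      {- int (neg_count n l) .. int (nonneg_count n l) - 1}"
    by (rule bij_betw_chi_exponent[OF n])
  have \<sigma>: "int (\<sigma> k) = chi_exponent n k + int (neg_count n l)" if "k < l" for k
    using bspec[OF bij_betwE[OF bij_e], of k] that by (auto simp: \<sigma>_def)
  have "inj_on \<sigma> {..<l}"
  proof (rule inj_onI)
    fix i j assume ij: "i \<in> {..<l}" "j \<in> {..<l}" "\<sigma> i = \<sigma> j"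
    then have "chi_exponent n i = chi_exponent n j" using \<sigma>[of i] \<sigma>[of j] by simp
    then show "i = j" using ij bij_betw_imp_inj_on[OF bij_e] by (auto dest: inj_onD)
  qed
  moreover have "\<sigma> ` {..<l} \<subseteq> {..<l}"
  proof
    fix x assume "x \<in> \<sigma> ` {..<l}"
    then obtain k where k: "k < l" "x = \<sigma> k" by auto
    then have "chi_exponent n k \<le> int (nonneg_count n l) - 1"
      using bspec[OF bij_betwE[OF bij_e], of k] by auto
    then show "x \<in> {..<l}" using \<sigma>[OF k(1)] k(2) count_add[of n l] by simp
  qed
  ultimately have bij: "bij_betw \<sigma> {..<l} {..<l}"
    by (simp add: bij_betw_def endo_inj_surj)
  show ?thesis
  proof
    assume "det ?A = 0"
    then obtain v where v: "v \<in> carrier_vec l" "v \<noteq> 0\<^sub>v l" "?A *\<^sub>v v = 0\<^sub>v l"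
      using det_0_iff_vec_prod_zero[of ?A l] by (auto simp: moment_block_def)
    define w where "w = vec l (\<lambda>i. v $ inv_into {..<l} \<sigma> i)"
    have w: "w $ \<sigma> k = v $ k" if "k < l" for k
      using that bij bij_betwE[OF bij] by (simp add: w_def bij_betw_inv_into_left)
    have "?T *\<^sub>v w = 0\<^sub>v l"
    proof (rule eq_vecI)
      fix i assume "i < dim_vec (0\<^sub>v l :: complex vec)"
      then have "i < l" by simp
      then obtain i' where i': "i' < l" "i = \<sigma> i'" using bij by (auto simp: bij_betw_def)
      have "(?T *\<^sub>v w) $ i = (\<Sum>j<l. circle_moment \<mu> (int i - int j) * w $ j)"
        using \<open>i < l\<close> Suc
        by (simp add: toeplitz_matrix_def scalar_prod_def circle_moment_def w_def lessThan_atLeast0)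
      also have "\<dots> = (\<Sum>k<l. circle_moment \<mu> (int i - int (\<sigma> k)) * w $ \<sigma> k)"
        by (rule sum.reindex_bij_betw[OF bij, symmetric])
      also have "\<dots> = (\<Sum>k<l. moment \<mu> n i' k * v $ k)"
        using i' by (intro sum.cong refl) (simp add: w \<sigma> moment_eq)
      also have "\<dots> = (?A *\<^sub>v v) $ i'"
        using i' v(1) by (simp add: moment_block_def scalar_prod_def lessThan_atLeast0)
      also have "\<dots> = 0\<^sub>v l $ i" using v(3) i' \<open>i < l\<close> by simp
      finally show "(?T *\<^sub>v w) $ i = 0\<^sub>v l $ i" .
    qed (simp add: toeplitz_matrix_def Suc)
    moreover have "w \<noteq> 0\<^sub>v l"
    proof
      assume 0: "w = 0\<^sub>v l"
      have "v = 0\<^sub>v l"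
      proof (rule eq_vecI)
        fix k assume "k < dim_vec (0\<^sub>v l :: complex vec)"
        then show "v $ k = 0\<^sub>v l $ k"
          using w[of k] bij_betwE[OF bij] 0 by simp
      qed (use v in simp)
      then show False using v by simp
    qed
    moreover have "w \<in> carrier_vec l" by (simp add: w_def)
    ultimately have "det ?T = 0"
      using det_0_iff_vec_prod_zero[of ?T l] Suc by (auto simp: toeplitz_matrix_def)
    then show False using qd by (simp add: quasi_definite_def)
  qed
qed

lemma moment_block_inv:
  assumes "quasi_definite \<mu>" and "fst n > 0" "snd n > 0"
  shows "moment_block_inv \<mu> n l \<in> carrier_mat l l"
    "block_inverse (moment \<mu> n) l (\<lambda>i j. moment_block_inv \<mu> n l $$ (i, j))"
proof -
  let ?A = "moment_block \<mu> n l" and ?B = "moment_block_inv \<mu> n l"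
  have A: "?A \<in> carrier_mat l l" by (simp add: moment_block_def)
  have "?A \<in> Units (ring_mat TYPE(complex) l ())"
    by (rule det_non_zero_imp_unit[OF A det_moment_block_nonzero[OF assms]])
  then obtain C where C: "mat_inverse ?A = Some C"
    using mat_inverse(1)[OF A, where b = "()"] by (cases "mat_inverse ?A") auto
  then have B: "?A * ?B = 1\<^sub>m l" "?B * ?A = 1\<^sub>m l" "?B \<in> carrier_mat l l"
    using mat_inverse(2)[OF A C] by (simp_all add: moment_block_inv_def)
  show "?B \<in> carrier_mat l l" by fact
  have "(?A * ?B) $$ (i, j) = (\<Sum>k<l. moment \<mu> n i k * ?B $$ (k, j))"
    "(?B * ?A) $$ (i, j) = (\<Sum>k<l. ?B $$ (i, k) * moment \<mu> n k j)" if "i < l" "j < l" for i j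
    using that B(3) by (simp_all add: moment_block_def scalar_prod_def lessThan_atLeast0)
  then show "block_inverse (moment \<mu> n) l (\<lambda>i j. ?B $$ (i, j))"
    by (simp add: block_inverse_def B(1,2) smat_one_def)
qed

section \<open>The Christoffel--Darboux formula\<close>

lemma cd_kernel_eq_solution:
  assumes "quasi_definite \<mu>" and "fst n > 0" "snd n > 0"
    and q: "\<And>i. i < l \<Longrightarrow> (\<Sum>k<l. moment \<mu> n i k * q k) = chi n i z'"
  shows "cd_kernel \<mu> n l z z' = (\<Sum>i<l. cnj (chi n i z) * q i)"
proof -
  define S1 S2 where "S1 = fst (gauss_factors \<mu> n)" and "S2 = snd (gauss_factors \<mu> n)"
  have "gauss_borel (moment \<mu> n) S1 S2"
    unfolding S1_def S2_def gauss_factors_def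
    by (rule someI_ex[OF ex_gauss_borel]) (use moment_block_inv(2)[OF assms(1-3)] in blast)
  note gb = this
  have nz: "S2 i i \<noteq> 0" for i
    by (rule gauss_borel_diag_nonzero[OF gb moment_block_inv(2)[OF assms(1-3)]])
  have "upper_tri S2" using gb by (simp add: gauss_borel_def)
  then have U: "lower_tri (smat_dagger (upper_inverse S2))"
    using upper_inverse(1)[OF \<open>upper_tri S2\<close> nz] by (simp add: lower_tri_def upper_tri_def smat_dagger_def)
  have "conj_laurent (phi2 \<mu> n k) (cnj z) = (\<Sum>i<l. cnj (chi n i z) * upper_inverse S2 i k)"
    if "k < l" for k
    by (simp add: conj_laurent_def phi2_def smat_vec_mult_lower[OF U that] flip: S2_def)
      (simp add: smat_dagger_def mult.commute)
  then have "cd_kernel \<mu> n l z z' = (\<Sum>k<l. smat_vec_mult S1 (\<lambda>k. chi n k z') k *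
      (\<Sum>i<l. cnj (chi n i z) * upper_inverse S2 i k))"
    by (simp add: cd_kernel_def phi1_def flip: S1_def)
  also have "\<dots> = (\<Sum>i<l. cnj (chi n i z) * q i)"
    by (rule kernel_eq_solution[OF gb nz q])
  finally show ?thesis .
qed

theorem theorem6:
  fixes \<mu> :: "complex set \<Rightarrow> complex" and n :: "nat \<times> nat" and l :: nat and z z' :: complex
  assumes "complex_borel_measure \<mu>"
    and "supported_on_circle \<mu>"
    and "quasi_definite \<mu>"
    and "l \<ge> 1"
    and "\<exists>l'\<ge>l. chi_kind n l' = 1"
    and "\<exists>l'\<ge>l. chi_kind n l' = 2"
    and "\<exists>l'\<le>l - 1. chi_kind n l' = 1"
    and "\<exists>l'\<le>l - 1. chi_kind n l' = 2"
    and "z \<noteq> 0" and "z' \<noteq> 0" and "z' * cnj z \<noteq> 1"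
  shows "cd_kernel \<mu> n l z z' =
    (cnj z * conj_laurent (phi2_plus \<mu> n 2 l) (cnj z) * phi1_minus \<mu> n 2 (l - 1) z' -
     phi1_plus \<mu> n 1 l z' * cnj z * conj_laurent (phi2_minus \<mu> n 1 (l - 1)) (cnj z)) /
    (1 - z' * cnj z)"
proof -
  have n: "fst n > 0" "snd n > 0"
    using both_kinds_imp_pos assms(5,6) by blast+
  define G where "G = moment_block_inv \<mu> n l"
  define p where "p k = (\<Sum>i<l. cnj (chi n i z) * G $$ (i, k))" for k
  define q where "q k = (\<Sum>j<l. G $$ (k, j) * chi n j z')" for k
  define a b where "a = - int (neg_count n l)" and "b = int (nonneg_count n l) - 1"
  let ?e = "chi_exponent n" and ?c = "circle_moment \<mu>"
  let ?r = "prev_index n 2 (l - 1)" and ?s = "prev_index n 1 (l - 1)"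
  have G: "G \<in> carrier_mat l l" and inv: "block_inverse (moment \<mu> n) l (\<lambda>i j. G $$ (i, j))"
    unfolding G_def by (rule moment_block_inv[OF assms(3) n])+
  have cnj_chi: "cnj (chi n i z) = cnj z powi ?e i" for i
    by (simp add: chi_def)
  (* The last positions of either kind below l carry the extreme exponents a and b; the next ones carry
     their outer neighbours a - 1 and b + 1. *)
  have r: "?r < l" "?e ?r = a" and s: "?s < l" "?e ?s = b"
    using prev_index(1)[OF assms(7)] prev_index(1)[OF assms(8)] assms(4,7,8)
      chi_exponent_prev_index[OF n, of l] by (auto simp: a_def b_def)
  have e_next: "?e (next_index n 1 l) = b + 1" "?e (next_index n 2 l) = a - 1"
    using chi_exponent_next_index[OF n] assms(5,6) by (auto simp: a_def b_def)
  have p_eq: "(\<Sum>k<l. p k * moment \<mu> n k j) = cnj (chi n j z)" if "j < l" for j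
  proof -
    have "(\<Sum>k<l. p k * moment \<mu> n k j) = (\<Sum>i<l. cnj (chi n i z) * smat_one i j)"
      unfolding p_def sum_mult_sum_assoc using inv that
      by (intro sum.cong refl) (simp add: block_inverse_def)
    then show ?thesis using that by (simp add: sum_smat_one)
  qed
  have q_eq: "(\<Sum>k<l. moment \<mu> n i k * q k) = chi n i z'" if "i < l" for i
  proof -
    have "(\<Sum>k<l. moment \<mu> n i k * q k) = (\<Sum>j<l. smat_one i j * chi n j z')"
      unfolding q_def sum_mult_sum_assoc[symmetric] using inv that
      by (intro sum.cong refl) (simp add: block_inverse_def)
    then show ?thesis using that by (simp add: sum_smat_one)
  qed
  have Gv_carrier: "G *\<^sub>v chi_block n l z' \<in> carrier_vec l"
    and Gu_carrier: "mat_dagger G *\<^sub>v chi_block n l z \<in> carrier_vec l"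
    using G by (auto simp: chi_block_def mat_dagger_def)
  have Gv: "(G *\<^sub>v chi_block n l z') $ k = q k" if "k < l" for k
    using G that by (simp add: q_def chi_block_def scalar_prod_def lessThan_atLeast0)
  have Gu: "cnj ((mat_dagger G *\<^sub>v chi_block n l z) $ k) = p k" if "k < l" for k
    using G that
    by (simp add: p_def chi_block_def mat_dagger_def scalar_prod_def lessThan_atLeast0 mult.commute)
  have plus1: "phi1_plus \<mu> n 1 l z' = z' powi (b + 1) - (\<Sum>k<l. ?c (b + 1 - ?e k) * q k)"
    using G Gv by (simp add: phi1_plus_def scalar_prod_def chi_def moment_eq e_next
        lessThan_atLeast0 del: One_nat_def flip: G_def)
  have plus2: "conj_laurent (phi2_plus \<mu> n 2 l) (cnj z) =
      cnj z powi (a - 1) - (\<Sum>k<l. p k * ?c (?e k - (a - 1)))"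
    using G Gu by (simp add: conj_laurent_def phi2_plus_def scalar_prod_def chi_def moment_eq e_next
        mat_dagger_def lessThan_atLeast0 mult.commute flip: G_def)
  have "l - 1 + 1 = l" using assms(4) by simp
  have minus1: "phi1_minus \<mu> n 2 (l - 1) z' = q ?r"
    unfolding phi1_minus_def \<open>l - 1 + 1 = l\<close> G_def[symmetric]
    using r(1) by (simp only: scalar_prod_left_unit[OF Gv_carrier] Gv)
  have minus2: "conj_laurent (phi2_minus \<mu> n 1 (l - 1)) (cnj z) = p ?s"
    unfolding conj_laurent_def phi2_minus_def \<open>l - 1 + 1 = l\<close> complex_cnj_cnj G_def[symmetric]
    using s(1) by (simp only: scalar_prod_left_unit[OF Gu_carrier] Gu)
  have "(1 - z' * cnj z) * (\<Sum>k<l. cnj z powi ?e k * q k) =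
    cnj z * (cnj z powi (a - 1) - (\<Sum>k<l. p k * ?c (?e k - (a - 1)))) * q ?r -
    (z' powi (b + 1) - (\<Sum>k<l. ?c (b + 1 - ?e k) * q k)) * cnj z * p ?s"
  proof (rule toeplitz_christoffel_darboux)
    show "bij_betw ?e {..<l} {a..b}"
      unfolding a_def b_def by (rule bij_betw_chi_exponent[OF n])
  qed (use r s assms(9,10) p_eq q_eq in \<open>simp_all add: moment_eq cnj_chi\<close>, simp_all add: chi_def)
  moreover have "cd_kernel \<mu> n l z z' = (\<Sum>k<l. cnj z powi ?e k * q k)"
    using cd_kernel_eq_solution[OF assms(3) n q_eq] by (simp add: cnj_chi)
  ultimately show ?thesis
    unfolding plus1 plus2 minus1 minus2 using assms(11) by (simp add: field_simps)
qed

end
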